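(* Let $\mathbf V$ be a finite-dimensional complex vector space with two compatible associative multiplications $\star$ and $\circ$. Let $m\ge 1$, let $F_m$ be the space of polynomials in one variable $t$ of degree less than $m$, and let $q(u)\in\mathbb C[u]$ be an arbitrary polynomial of degree $m$. For $x\in\mathbf V$ put $x_i=x\otimes t^i\in\mathbf V\otimes F_m$ ($0\le i\le m-1$) and $$x(u)=x_0+x_1u+\dots+x_{m-1}u^{m-1}.$$ Then the formula $$x(u)\,y(v)=\frac{q(u)}{u-v}\Big((x\star y)(v)+v\,(x\circ y)(v)\Big)+\frac{q(v)}{v-u}\Big((x\star y)(u)+u\,(x\circ y)(u)\Big),\qquad x,y\in\mathbf V,$$ defines an associative multiplication on the vector space $\mathbf V\otimes F_m$.
   Context: Two associative multiplications $\star,\circ$ on the same vector space are compatible if $a\star b+\lambda\, a\circ b$ is an associative multiplication for every constant $\lambda\in\mathbb C$. The formula is an identity of polynomials in the two formal variables $u,v$ with coefficients in $\mathbf V\otimes F_m$: the left-hand side is $\sum_{i,j}x_iy_j\,u^iv^j$, and the product $x_iy_j\in\mathbf V\otimes F_m$ is defined as the coefficient of $u^iv^j$ on the right-hand side, $0\le i,j\le m-1$. *)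

theory Defs
  imports "HOL-Computational_Algebra.Polynomial"
begin

text \<open>Linear and bilinear maps on carrier sets. The scalar multiplications are explicit arguments,
  as in \<^theory>\<open>HOL.Vector_Spaces\<close>.\<close>

definition linear_on ::
  "'v set \<Rightarrow> ('k \<Rightarrow> 'v \<Rightarrow> 'v) \<Rightarrow> ('k \<Rightarrow> 'w \<Rightarrow> 'w) \<Rightarrow> ('v::ab_group_add \<Rightarrow> 'w::ab_group_add) \<Rightarrow> bool"
  where "linear_on S s s' f \<longleftrightarrow>
    (\<forall>x\<in>S. \<forall>y\<in>S. f (x + y) = f x + f y) \<and> (\<forall>c. \<forall>x\<in>S. f (s c x) = s' c (f x))"

definition bilinear_on ::
  "'a set \<Rightarrow> ('k \<Rightarrow> 'a \<Rightarrow> 'a) \<Rightarrow> 'b set \<Rightarrow> ('k \<Rightarrow> 'b \<Rightarrow> 'b) \<Rightarrow> ('k \<Rightarrow> 'c \<Rightarrow> 'c) \<Rightarrow>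
    ('a::ab_group_add \<Rightarrow> 'b::ab_group_add \<Rightarrow> 'c::ab_group_add) \<Rightarrow> bool"
  where "bilinear_on S1 s1 S2 s2 s3 f \<longleftrightarrow>
    (\<forall>y\<in>S2. linear_on S1 s1 s3 (\<lambda>x. f x y)) \<and> (\<forall>x\<in>S1. linear_on S2 s2 s3 (f x))"

definition multiplication_on ::
  "'v set \<Rightarrow> ('k \<Rightarrow> 'v \<Rightarrow> 'v) \<Rightarrow> ('v::ab_group_add \<Rightarrow> 'v \<Rightarrow> 'v) \<Rightarrow> bool"
  where "multiplication_on S s mul \<longleftrightarrow>
    (\<forall>x\<in>S. \<forall>y\<in>S. mul x y \<in> S) \<and> bilinear_on S s S s s mul"

definition associative_multiplication_on ::
  "'v set \<Rightarrow> ('k \<Rightarrow> 'v \<Rightarrow> 'v) \<Rightarrow> ('v::ab_group_add \<Rightarrow> 'v \<Rightarrow> 'v) \<Rightarrow> bool"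
  where "associative_multiplication_on S s mul \<longleftrightarrow>
    multiplication_on S s mul \<and>
    (\<forall>x\<in>S. \<forall>y\<in>S. \<forall>z\<in>S. mul (mul x y) z = mul x (mul y z))"

definition compatible_multiplications ::
  "('k \<Rightarrow> 'v \<Rightarrow> 'v) \<Rightarrow> ('v::ab_group_add \<Rightarrow> 'v \<Rightarrow> 'v) \<Rightarrow> ('v \<Rightarrow> 'v \<Rightarrow> 'v) \<Rightarrow> bool"
  where "compatible_multiplications s star circ \<longleftrightarrow>
    (\<forall>c. associative_multiplication_on UNIV s (\<lambda>a b. star a b + s c (circ a b)))"

definition Fspace :: "nat \<Rightarrow> complex poly set"
  where "Fspace m = {p. degree p < m}"

text \<open>The tensor product of a complex vector space V with the polynomials of degree less than m
  is modelled by the polynomials of degree less than m with coefficients in V, where the tensor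
  of x and p multiplies each coefficient of p by x. The lemmas up to \<open>tensor_space_universal\<close>
  show that this is a tensor product: a vector space with a bilinear map that has the universal
  property.\<close>

definition coeff_scale :: "(complex \<Rightarrow> 'v \<Rightarrow> 'v) \<Rightarrow> complex \<Rightarrow> 'v::ab_group_add poly \<Rightarrow> 'v poly"
  where "coeff_scale s c = map_poly (s c)"

definition tensor_space :: "nat \<Rightarrow> 'v::ab_group_add poly set"
  where "tensor_space m = {w. degree w < m}"

definition tensor :: "(complex \<Rightarrow> 'v \<Rightarrow> 'v) \<Rightarrow> 'v \<Rightarrow> complex poly \<Rightarrow> 'v::ab_group_add poly"
  where "tensor s x p = map_poly (\<lambda>c. s c x) p"

lemma coeff_coeff_scale:
  assumes "vector_space s"
  shows "coeff (coeff_scale s c w) n = s c (coeff w n)"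
proof -
  interpret vector_space s by fact
  show ?thesis by (simp add: coeff_scale_def coeff_map_poly)
qed

lemma coeff_tensor:
  assumes "vector_space s"
  shows "coeff (tensor s x p) n = s (coeff p n) x"
proof -
  interpret vector_space s by fact
  show ?thesis by (simp add: tensor_def coeff_map_poly)
qed

lemma vector_space_coeff_scale:
  assumes "vector_space s"
  shows "vector_space (coeff_scale s)"
proof -
  interpret vector_space s by fact
  show ?thesis
    by unfold_locales
      (simp_all add: poly_eq_iff coeff_coeff_scale[OF assms] scale_right_distrib scale_left_distrib)
qed

lemma subspace_tensor_space:
  assumes "vector_space s" "m \<ge> 1"
  shows "module.subspace (coeff_scale s) (tensor_space m)"
proof -
  interpret W: vector_space "coeff_scale s" by (rule vector_space_coeff_scale) fact
  have "degree (coeff_scale s c w) \<le> degree w" for c w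
    unfolding coeff_scale_def by (rule map_poly_degree_leq)
  then show ?thesis
    using assms(2) by (auto simp: W.subspace_def tensor_space_def degree_add_less intro: le_less_trans)
qed

lemma tensor_in_tensor_space: "p \<in> Fspace m \<Longrightarrow> tensor s x p \<in> tensor_space m"
  unfolding tensor_def Fspace_def tensor_space_def
  using map_poly_degree_leq[of "\<lambda>c. s c x" p] by simp

lemma bilinear_tensor:
  assumes "vector_space s"
  shows "bilinear_on UNIV s (Fspace m) smult (coeff_scale s) (tensor s)"
proof -
  interpret vector_space s by fact
  show ?thesis
    by (simp add: bilinear_on_def linear_on_def poly_eq_iff coeff_tensor[OF assms]
        coeff_coeff_scale[OF assms] scale_right_distrib scale_left_distrib mult.commute)
qed

lemma tensor_space_expand:
  assumes "vector_space s" "w \<in> tensor_space m"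
  shows "w = (\<Sum>i<m. tensor s (coeff w i) (monom 1 i))"
proof -
  interpret vector_space s by fact
  show ?thesis
  proof (rule poly_eqI)
    fix n
    have "coeff (\<Sum>i<m. tensor s (coeff w i) (monom 1 i)) n
        = (\<Sum>i<m. if i = n then coeff w i else 0)"
      unfolding coeff_sum by (rule sum.cong) (auto simp: coeff_tensor[OF assms(1)])
    also have "\<dots> = coeff w n"
      using assms(2) by (auto simp: tensor_space_def coeff_eq_0)
    finally show "coeff w n = coeff (\<Sum>i<m. tensor s (coeff w i) (monom 1 i)) n" by simp
  qed
qed

lemma linear_on_sum:
  assumes V: "vector_space s" and W: "vector_space s'"
    and S: "module.subspace s S" and f: "linear_on S s s' f"
    and "finite I" "\<And>i. i \<in> I \<Longrightarrow> g i \<in> S"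
  shows "f (\<Sum>i\<in>I. g i) = (\<Sum>i\<in>I. f (g i))"
proof -
  interpret V: vector_space s by fact
  interpret W: vector_space s' by fact
  have zero: "f 0 = 0"
    using f V.subspace_0[OF S] unfolding linear_on_def by (metis add_cancel_right_left)
  show ?thesis
    using assms(5,6)
  proof (induction I rule: finite_induct)
    case (insert i I)
    then have "(\<Sum>i\<in>I. g i) \<in> S" by (intro V.subspace_sum[OF S]) auto
    with insert f show ?case by (simp add: linear_on_def)
  qed (simp add: zero)
qed

lemma tensor_space_universal:
  fixes f :: "'v::ab_group_add \<Rightarrow> complex poly \<Rightarrow> 'x::ab_group_add"
  assumes V: "vector_space s" and X: "vector_space sX" and m: "m \<ge> 1"
    and f: "bilinear_on UNIV s (Fspace m) smult sX f"
  shows "\<exists>g. linear_on (tensor_space m) (coeff_scale s) sX g \<and>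
      (\<forall>x. \<forall>p\<in>Fspace m. g (tensor s x p) = f x p) \<and>
      (\<forall>g'. linear_on (tensor_space m) (coeff_scale s) sX g' \<and>
          (\<forall>x. \<forall>p\<in>Fspace m. g' (tensor s x p) = f x p) \<longrightarrow>
        (\<forall>w\<in>tensor_space m. g' w = g w))"
proof -
  interpret V: vector_space s by fact
  interpret X: vector_space sX by fact
  interpret P: vector_space "smult :: complex \<Rightarrow> _"
    by unfold_locales (simp_all add: smult_add_right smult_add_left)
  have mono: "monom 1 i \<in> Fspace m" if "i < m" for i
    using that by (simp add: Fspace_def degree_monom_eq)
  have subF: "module.subspace smult (Fspace m)"
    using m by (auto simp: P.subspace_def Fspace_def degree_add_less)
  have fl: "f (x + y) p = f x p + f y p" "f (s c x) p = sX c (f x p)" if "p \<in> Fspace m" for x y c p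
    using f that by (auto simp: bilinear_on_def linear_on_def)
  have fr: "linear_on (Fspace m) smult sX (f x)" for x
    using f by (auto simp: bilinear_on_def)
  define g where "g w = (\<Sum>i<m. f (coeff w i) (monom 1 i))" for w
  have 1: "linear_on (tensor_space m) (coeff_scale s) sX g"
    unfolding linear_on_def g_def
    by (simp add: coeff_coeff_scale[OF V] fl mono sum.distrib X.scale_sum_right)
  have 2: "g (tensor s x p) = f x p" if p: "p \<in> Fspace m" for x p
  proof -
    have "p = (\<Sum>i<m. smult (coeff p i) (monom 1 i))"
      using p by (intro poly_eqI) (auto simp: coeff_sum Fspace_def coeff_eq_0 if_distrib cong: if_cong)
    then have "f x p = f x (\<Sum>i<m. smult (coeff p i) (monom 1 i))" by simp
    also have "\<dots> = (\<Sum>i<m. f x (smult (coeff p i) (monom 1 i)))"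
      by (rule linear_on_sum[OF P.vector_space_axioms X subF fr])
        (auto intro!: P.subspace_scale[OF subF] mono)
    also have "\<dots> = (\<Sum>i<m. f (s (coeff p i) x) (monom 1 i))"
      using fr[of x] by (intro sum.cong) (auto simp: linear_on_def mono fl)
    finally show ?thesis by (simp add: g_def coeff_tensor[OF V])
  qed
  have 3: "g' w = g w" if g': "linear_on (tensor_space m) (coeff_scale s) sX g'"
      "\<forall>x. \<forall>p\<in>Fspace m. g' (tensor s x p) = f x p" and w: "w \<in> tensor_space m" for g' w
  proof -
    have "g' w = g' (\<Sum>i<m. tensor s (coeff w i) (monom 1 i))"
      using tensor_space_expand[OF V w] by simp
    also have "\<dots> = (\<Sum>i<m. g' (tensor s (coeff w i) (monom 1 i)))"
      by (rule linear_on_sum[OF vector_space_coeff_scale[OF V] X subspace_tensor_space[OF V m] g'(1)])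
        (auto intro!: tensor_in_tensor_space mono)
    also have "\<dots> = g w" using g'(2) by (simp add: g_def mono)
    finally show ?thesis .
  qed
  from 1 2 3 show ?thesis by blast
qed

text \<open>The action of the polynomials over k on the polynomials with coefficients in a k-module,
  given the action \<open>s\<close> of k. Iterating it gives the action of the polynomials in two variables.\<close>

definition poly_act :: "('k \<Rightarrow> 'w \<Rightarrow> 'w) \<Rightarrow> 'k::zero poly \<Rightarrow> 'w::ab_group_add poly \<Rightarrow> 'w poly"
  where "poly_act s p A =
    (\<Sum>i\<le>degree p. \<Sum>j\<le>degree A. monom (s (coeff p i) (coeff A j)) (i + j))"

lemma coeff_poly_act:
  fixes s :: "'k::zero \<Rightarrow> 'w::ab_group_add \<Rightarrow> 'w"
  assumes "\<And>w. s 0 w = 0" "\<And>c. s c 0 = 0"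
  shows "coeff (poly_act s p A) n = (\<Sum>i\<le>n. s (coeff p i) (coeff A (n - i)))"
proof -
  have inner: "(\<Sum>j\<le>degree A. if i + j = n then s (coeff p i) (coeff A j) else 0)
      = (if i \<le> n then s (coeff p i) (coeff A (n - i)) else 0)" for i
  proof -
    have "(\<Sum>j\<le>degree A. if i + j = n then s (coeff p i) (coeff A j) else 0)
        = (\<Sum>j\<le>degree A. if j = n - i then (if i \<le> n then s (coeff p i) (coeff A j) else 0) else 0)"
      by (rule sum.cong) auto
    also have "\<dots> = (if i \<le> n then s (coeff p i) (coeff A (n - i)) else 0)"
      by (auto simp: coeff_eq_0 assms)
    finally show ?thesis .
  qed
  have "coeff (poly_act s p A) n
      = (\<Sum>i\<le>degree p. if i \<le> n then s (coeff p i) (coeff A (n - i)) else 0)"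
    by (simp add: poly_act_def coeff_sum inner)
  also have "\<dots> = (\<Sum>i\<in>{..degree p} \<inter> {..n}. s (coeff p i) (coeff A (n - i)))"
    by (subst sum.inter_restrict) (auto intro: sum.cong)
  also have "\<dots> = (\<Sum>i\<le>n. s (coeff p i) (coeff A (n - i)))"
    by (rule sum.mono_neutral_left) (auto, metis assms(1) le_degree)
  finally show ?thesis .
qed

text \<open>Polynomials in u and v are polynomials in u whose coefficients are polynomials in v.
  The next two functions turn p into p(u) and p(v).\<close>

definition in_u :: "'a::zero poly \<Rightarrow> 'a poly poly"
  where "in_u p = map_poly (\<lambda>c. [:c:]) p"

definition in_v :: "'a::zero poly \<Rightarrow> 'a poly poly"
  where "in_v p = [:p:]"

definition gen_poly :: "(complex \<Rightarrow> 'v \<Rightarrow> 'v) \<Rightarrow> nat \<Rightarrow> 'v \<Rightarrow> 'v::ab_group_add poly poly"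
  where "gen_poly s m x = (\<Sum>i<m. monom (tensor s x (monom 1 i)) i)"

definition gen_product ::
  "(complex \<Rightarrow> 'v \<Rightarrow> 'v) \<Rightarrow> nat \<Rightarrow> ('v::ab_group_add poly \<Rightarrow> 'v poly \<Rightarrow> 'v poly) \<Rightarrow> 'v \<Rightarrow> 'v \<Rightarrow>
    'v poly poly poly"
  where "gen_product s m mul x y =
    (\<Sum>i<m. \<Sum>j<m. monom (monom (mul (tensor s x (monom 1 i)) (tensor s y (monom 1 j))) j) i)"

lemma poly_act_u_minus_v_cancel:
  fixes P :: "'w::ab_group_add poly poly"
  assumes "vector_space (t :: complex \<Rightarrow> 'w \<Rightarrow> 'w)"
    and "poly_act (poly_act t) (in_u [:0, 1:] - in_v [:0, 1:]) P = 0"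
  shows "P = 0"
proof -
  interpret vector_space t by fact
  have c1: "coeff (poly_act t p A) n = (\<Sum>i\<le>n. t (coeff p i) (coeff A (n - i)))" for p A n
    by (rule coeff_poly_act) simp_all
  have z: "poly_act t 0 A = 0" "poly_act t p 0 = 0" for p A
    by (simp_all add: poly_eq_iff c1)
  have c2: "coeff (poly_act (poly_act t) p A) n
      = (\<Sum>i\<le>n. poly_act t (coeff p i) (coeff A (n - i)))" for p A n
    by (rule coeff_poly_act) (simp_all add: z)
  have uv: "in_u [:0, 1:] - in_v [:0, 1:] = [:- [:0, 1:], 1 :: complex poly:]"
    by (simp add: in_u_def in_v_def map_poly_pCons)
  have one: "poly_act t 1 A = A" for A
  proof (rule poly_eqI)
    fix n
    have "(\<Sum>i\<le>n. t (coeff 1 i) (coeff A (n - i)))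
        = (\<Sum>i\<in>{0}. t (coeff 1 i) (coeff A (n - i)))"
      by (rule sum.mono_neutral_right) auto
    then show "coeff (poly_act t 1 A) n = coeff A n" by (simp add: c1)
  qed
  have step: "coeff P n = - poly_act t (- [:0, 1:]) (coeff P (Suc n))" for n
  proof -
    have "0 = (\<Sum>i\<le>Suc n. poly_act t (coeff [:- [:0, 1:], 1:] i) (coeff P (Suc n - i)))"
      using assms(2) c2[of "[:- [:0, 1:], 1:]" P "Suc n"] by (simp add: uv)
    also have "\<dots> = (\<Sum>i\<in>{0, Suc 0}. poly_act t (coeff [:- [:0, 1:], 1:] i) (coeff P (Suc n - i)))"
      by (rule sum.mono_neutral_right) (auto simp: coeff_pCons z split: nat.splits)
    finally show ?thesis by (simp add: one algebra_simps eq_neg_iff_add_eq_0)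
  qed
  have "coeff P n = 0" if "n + k = Suc (degree P)" for n k
    using that
  proof (induction k arbitrary: n)
    case 0
    then show ?case by (simp add: coeff_eq_0)
  next
    case (Suc k)
    then have "coeff P (Suc n) = 0" by simp
    with step[of n] show ?case by (simp add: z)
  qed
  then have "coeff P n = 0" for n
    by (cases "n \<le> Suc (degree P)") (auto simp: coeff_eq_0 dest: le_Suc_ex)
  then show ?thesis by (simp add: poly_eq_iff)
qed

text \<open>The formula for \<open>x(u) y(v)\<close> is an identity of polynomials in u and v, stated here after
  multiplication by u - v, which is injective (\<open>poly_act_u_minus_v_cancel\<close>).
  Below, \<open>A\<close> is \<open>(x \<star> y)(z) + z (x \<circ> y)(z)\<close> as a polynomial in z.\<close>

definition product_formula ::
  "(complex \<Rightarrow> 'v \<Rightarrow> 'v) \<Rightarrow> nat \<Rightarrow> complex poly \<Rightarrow> ('v \<Rightarrow> 'v \<Rightarrow> 'v) \<Rightarrow> ('v \<Rightarrow> 'v \<Rightarrow> 'v) \<Rightarrow>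
    ('v::ab_group_add poly \<Rightarrow> 'v poly \<Rightarrow> 'v poly) \<Rightarrow> bool"
  where "product_formula s m q star circ mul \<longleftrightarrow>
    (\<forall>x y.
      let act1 = poly_act (coeff_scale s);
          act2 = poly_act act1;
          u = in_u [:0, 1:];
          v = in_v [:0, 1:];
          A = gen_poly s m (star x y) + act1 [:0, 1:] (gen_poly s m (circ x y))
      in act2 (u - v) (gen_product s m mul x y)
          = act2 (in_u q) (in_v A) - act2 (in_v q) (in_u A))"

end

theory Submission
  imports Defs
begin

text \<open>Evaluate the generating functions at numbers. With \<open>x \<cdot>\<^sub>c y = x \<star> y + c (x \<circ> y)\<close> the formula reads
  \<open>(u - v) x(u) y(v) = q(u) (x \<cdot>\<^sub>v y)(v) - q(v) (x \<cdot>\<^sub>u y)(u)\<close>. Since \<open>\<cdot>\<^sub>c\<close> is affine in \<open>c\<close>,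
  \<open>(u - w) (x \<cdot>\<^sub>v y) - (v - w) (x \<cdot>\<^sub>u y) = (u - v) (x \<cdot>\<^sub>w y)\<close>, and this turns both
  \<open>(x(u) y(v)) z(w)\<close> and \<open>x(u) (y(v) z(w))\<close>, for distinct \<open>u, v, w\<close>, into the same combination of the
  values at \<open>u\<close>, \<open>v\<close>, \<open>w\<close> of the triple products of x, y, z under \<open>\<cdot>\<^sub>u\<close>, \<open>\<cdot>\<^sub>v\<close>, \<open>\<cdot>\<^sub>w\<close>. The associator
  is polynomial in \<open>u, v, w\<close>, so all its coefficients vanish.\<close>

section \<open>Vanishing of polynomials with vector coefficients\<close>

text \<open>The induction passes from \<open>f(z)\<close> to \<open>f(2z) - 2\<^sup>n f(z)\<close>, which removes the leading term.\<close>

lemma power_sum_cofinite_eq_0: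
  fixes a :: "nat \<Rightarrow> 'v::ab_group_add"
  assumes t: "vector_space (t :: complex \<Rightarrow> 'v \<Rightarrow> 'v)"
    and "finite S" "\<And>z. z \<notin> S \<Longrightarrow> (\<Sum>i<n. t (z ^ i) (a i)) = 0" "i < n"
  shows "a i = 0"
  using assms(2-)
proof (induction n arbitrary: a S i)
  case (Suc n)
  interpret vector_space t by (fact t)
  note fin = Suc.prems(1) and zero = Suc.prems(2)
  \<comment> \<open>Points \<open>z\<close> with \<open>2 * z\<close> in \<open>S\<close> are
    excluded as well, so that the hypothesis is available at both \<open>z\<close> and
    \<open>2 * z\<close>.\<close>
  define S' where "S' = S \<union> (\<lambda>z. 2 * z) -` S"
  have S': "finite S'"
    unfolding S'_def using fin by (auto intro!: finite_vimageI simp: inj_def)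
  have "(\<Sum>i<n. t (z ^ i) (t (2 ^ i - 2 ^ n) (a i))) = 0" if "z \<notin> S'" for z
  proof -
    have "z \<notin> S" "2 * z \<notin> S" using that by (auto simp: S'_def)
    then have "(\<Sum>i<Suc n. t ((2 * z) ^ i) (a i)) - t (2 ^ n) (\<Sum>i<Suc n. t (z ^ i) (a i)) = 0"
      unfolding zero[OF \<open>z \<notin> S\<close>] zero[OF \<open>2 * z \<notin> S\<close>] by simp
    then have "(\<Sum>i<Suc n. t (z ^ i) (t (2 ^ i - 2 ^ n) (a i))) = 0"
      by (simp only: scale_sum_right sum_subtractf[symmetric] scale_scale
          scale_left_diff_distrib[symmetric] power_mult_distrib right_diff_distrib mult.commute)
    then show ?thesis by simp
  qed
  then have "t (2 ^ i - 2 ^ n) (a i) = 0" if "i < n" for i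
    by (rule Suc.IH[OF S', where a = "\<lambda>i. t (2 ^ i - 2 ^ n) (a i)"]) (use that in auto)
  \<comment> \<open>The factors produced by the doubling are nonzero, since distinct powers of 2
    have distinct norms.\<close>
  moreover have "(2::complex) ^ i \<noteq> 2 ^ n" if "i < n" for i
  proof
    assume "(2::complex) ^ i = 2 ^ n"
    then have "norm ((2::complex) ^ i) = norm ((2::complex) ^ n)" by simp
    then show False using that by (simp add: norm_power)
  qed
  ultimately have low: "a i = 0" if "i < n" for i
    using that by auto
  \<comment> \<open>Once the lower coefficients vanish, any nonzero admissible point isolates
    \<open>a n\<close>.\<close>
  obtain z where z: "z \<notin> S \<union> {0::complex}"
    using ex_new_if_finite[OF infinite_UNIV_char_0, of "S \<union> {0}"] fin by auto
  then have "a n = 0"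
    using zero[of z] low by simp
  then show ?case
    using low Suc.prems(3) by (cases "i = n") auto
qed simp

section \<open>Coefficients of the polynomial actions and generating polynomials\<close>

lemma coeff_in_u: "coeff (in_u p) i = [:coeff p i:]"
  by (simp add: in_u_def coeff_map_poly)

lemma coeff_in_v: "coeff (in_v p) i = (if i = 0 then p else 0)"
  by (simp add: in_v_def coeff_pCons split: nat.split)

lemma coeff_const_poly: "coeff [:c:] i = (if i = 0 then c else 0)"
  by (simp add: coeff_pCons split: nat.split)

lemma tensor_monom:
  assumes "vector_space s"
  shows "tensor s x (monom 1 i) = monom x i"
proof -
  interpret vector_space s by fact
  show ?thesis by (simp add: poly_eq_iff coeff_tensor[OF assms])
qed

lemma tensor_space_expand_monom:
  assumes "vector_space (s :: complex \<Rightarrow> 'v \<Rightarrow> 'v)" "w \<in> tensor_space m"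
  shows "w = (\<Sum>i<m. monom (coeff w i) (i::nat) :: 'v::ab_group_add poly)"
  using tensor_space_expand[OF assms] by (simp add: tensor_monom[OF assms(1)])

lemma sum_atMost_only:
  fixes f :: "nat \<Rightarrow> 'b::comm_monoid_add"
  assumes "k \<le> n" "\<And>i. i \<le> n \<Longrightarrow> i \<noteq> k \<Longrightarrow> f i = 0"
  shows "(\<Sum>i\<le>n. f i) = f k"
proof -
  have "(\<Sum>i\<le>n. f i) = (\<Sum>i\<in>{k}. f i)"
    using assms by (intro sum.mono_neutral_right) auto
  then show ?thesis by simp
qed

lemma sum_atMost_shift:
  fixes f :: "nat \<Rightarrow> 'b::comm_monoid_add"
  assumes "f 0 = 0"
  shows "(\<Sum>i\<le>n. f i) = (\<Sum>i<n. f (Suc i))"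
  unfolding lessThan_Suc_atMost[symmetric] sum.lessThan_Suc_shift by (simp add: assms)

lemma sum_delta_pair:
  fixes c :: "'b::comm_monoid_add"
  shows "(\<Sum>k<m. \<Sum>l<n. if k = i \<and> l = j then c else 0) = (if i < (m::nat) \<and> j < (n::nat) then c else 0)"
proof -
  have "(\<Sum>k<m. \<Sum>l<n. if k = i \<and> l = j then c else 0) = (\<Sum>k<m. if k = i then if j < n then c else 0 else 0)"
    by (intro sum.cong) auto
  then show ?thesis by simp
qed

context
  fixes t :: "complex \<Rightarrow> 'w::ab_group_add \<Rightarrow> 'w"
  assumes t: "vector_space t"
begin

interpretation vector_space t by (fact t)

lemma coeff_poly_act_vs:
  "coeff (poly_act t p A) n = (\<Sum>i\<le>n. t (coeff p i) (coeff A (n - i)))"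
  by (rule coeff_poly_act) simp_all

lemma coeff_poly_act_poly_act:
  "coeff (coeff (poly_act (poly_act t) p A) n) k =
    (\<Sum>i\<le>n. \<Sum>j\<le>k. t (coeff (coeff p i) j) (coeff (coeff A (n - i)) (k - j)))"
proof -
  have "coeff (poly_act (poly_act t) p A) n = (\<Sum>i\<le>n. poly_act t (coeff p i) (coeff A (n - i)))"
    by (rule coeff_poly_act) (simp_all add: poly_eq_iff coeff_poly_act_vs)
  then show ?thesis by (simp add: coeff_sum coeff_poly_act_vs)
qed

lemma coeff_act_var:
  "coeff (poly_act t [:0, 1:] A) n = (if n = 0 then 0 else coeff A (n - 1))"
proof (cases n)
  case (Suc k)
  then show ?thesis
    unfolding coeff_poly_act_vs
    by (subst sum_atMost_only[where k = 1]) (auto simp: coeff_pCons split: nat.splits)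
qed (simp add: coeff_poly_act_vs)

text \<open>The outer index is the exponent of u and the inner one that of v, so multiplying by u or
  v shifts one index. This turns the product formula into a recurrence in two indices.\<close>

lemma coeff_act_u_minus_v:
  "coeff (coeff (poly_act (poly_act t) (in_u [:0, 1:] - in_v [:0, 1:]) P) i) j =
    (if i = 0 then 0 else coeff (coeff P (i - 1)) j) - (if j = 0 then 0 else coeff (coeff P i) (j - 1))"
proof -
  \<comment> \<open>As a polynomial in u, \<open>u - v\<close> has constant term \<open>- v\<close>
    and leading coefficient 1, so only two outer indices contribute.\<close>
  have uv: "in_u [:0, 1:] - in_v [:0, 1:] = [:- [:0, 1:], 1 :: complex poly:]"
    by (simp add: in_u_def in_v_def map_poly_pCons)
  have zero_case: "(\<Sum>l\<le>j. t (coeff (- [:0, 1:]) l) (coeff B (j - l))) = - (if j = 0 then 0 else coeff B (j - 1))" for B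
    using coeff_act_var[of B j]
    by (simp only: coeff_poly_act_vs coeff_minus scale_minus_left sum_negf)
  have 1: "(\<Sum>l\<le>j. t (coeff 1 l) (coeff B (j - l))) = coeff B j" for B
    by (subst sum_atMost_only[where k = 0]) auto
  show ?thesis
  proof (cases i)
    case (Suc k)
    have "coeff (coeff (poly_act (poly_act t) (in_u [:0, 1:] - in_v [:0, 1:]) P) i) j
      = (\<Sum>l\<in>{0, 1}. \<Sum>n\<le>j. t (coeff (coeff [:- [:0, 1:], 1:] l) n) (coeff (coeff P (i - l)) (j - n)))"
      unfolding coeff_poly_act_poly_act uv using Suc
      by (intro sum.mono_neutral_right) (auto simp: coeff_pCons split: nat.splits)
    also have "\<dots> = coeff (coeff P k) j - (if j = 0 then 0 else coeff (coeff P i) (j - 1))"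
      using zero_case[of "coeff P i"] 1[of "coeff P k"] Suc by simp
    finally show ?thesis using Suc by simp
  next
    case 0
    then show ?thesis using zero_case[of "coeff P 0"] by (simp add: coeff_poly_act_poly_act uv)
  qed
qed

lemma coeff_act_in_u_in_v:
  "coeff (coeff (poly_act (poly_act t) (in_u p) (in_v A)) i) j = t (coeff p i) (coeff A j)"
proof -
  have "coeff (coeff (poly_act (poly_act t) (in_u p) (in_v A)) i) j
    = (\<Sum>l\<le>j. t (coeff [:coeff p i:] l) (coeff A (j - l)))"
    unfolding coeff_poly_act_poly_act
    by (subst sum_atMost_only[where k = i]) (auto simp: coeff_in_u coeff_in_v)
  also have "\<dots> = t (coeff p i) (coeff A j)"
    by (subst sum_atMost_only[where k = 0]) (auto simp: coeff_const_poly)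
  finally show ?thesis .
qed

lemma coeff_act_in_v_in_u:
  "coeff (coeff (poly_act (poly_act t) (in_v p) (in_u A)) i) j = t (coeff p j) (coeff A i)"
proof -
  have "coeff (coeff (poly_act (poly_act t) (in_v p) (in_u A)) i) j
    = (\<Sum>l\<le>j. t (coeff p l) (coeff [:coeff A i:] (j - l)))"
    unfolding coeff_poly_act_poly_act
    by (subst sum_atMost_only[where k = 0]) (auto simp: coeff_in_u coeff_in_v)
  also have "\<dots> = t (coeff p j) (coeff A i)"
    by (subst sum_atMost_only[where k = j]) (auto simp: coeff_const_poly)
  finally show ?thesis .
qed

end

lemma coeff_gen_product:
  assumes "vector_space s"
  shows "coeff (coeff (gen_product s m mul x y) i) j =
    (if i < m \<and> j < m then mul (monom x i) (monom y j) else 0)"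
proof -
  have "coeff (coeff (gen_product s m mul x y) i) j
    = (\<Sum>k<m. \<Sum>l<m. if k = i \<and> l = j then mul (monom x i) (monom y j) else 0)"
    unfolding gen_product_def coeff_sum tensor_monom[OF assms]
    by (intro sum.cong refl) auto
  then show ?thesis by (simp only: sum_delta_pair)
qed

lemma coeff_gen_poly:
  assumes "vector_space s"
  shows "coeff (gen_poly s m x) i = (if i < m then monom x i else 0)"
  by (simp add: gen_poly_def coeff_sum tensor_monom[OF assms])

section \<open>Uniqueness of the product\<close>

text \<open>Cancelling \<open>u - v\<close> determines the products of the elements
  \<open>monom x i\<close> and \<open>monom y j\<close>; these span the space, and bilinearity gives
  the rest.\<close>

lemma product_formula_unique:
  assumes s: "vector_space s" and m: "m \<ge> 1"
    and "multiplication_on (tensor_space m) (coeff_scale s) mul"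
    and "multiplication_on (tensor_space m) (coeff_scale s) mul'"
    and "product_formula s m q star circ mul" "product_formula s m q star circ mul'"
    and a: "a \<in> tensor_space m" and b: "b \<in> tensor_space m"
  shows "mul' a b = mul a b"
proof -
  note W = vector_space_coeff_scale[OF s]
  have gen: "mul' (monom x i) (monom y j) = mul (monom x i) (monom y j)" if "i < m" "j < m" for x y i j
  proof -
    let ?act = "poly_act (poly_act (coeff_scale s)) (in_u [:0, 1:] - in_v [:0, 1:])"
    have "?act (gen_product s m mul' x y) = ?act (gen_product s m mul x y)"
      using assms(5,6) unfolding product_formula_def Let_def by metis
    moreover have "?act (P - Q) = ?act P - ?act Q" for P Q
      by (intro poly_eqI) (simp only: coeff_act_u_minus_v[OF W] coeff_diff split: if_split, simp)
    ultimately have "?act (gen_product s m mul' x y - gen_product s m mul x y) = 0"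
      by (simp only: diff_self)
    then have "gen_product s m mul' x y - gen_product s m mul x y = 0"
      by (rule poly_act_u_minus_v_cancel[OF W])
    then have "gen_product s m mul' x y = gen_product s m mul x y" by simp
    then have "coeff (coeff (gen_product s m mul' x y) i) j = coeff (coeff (gen_product s m mul x y) i) j"
      by simp
    then show ?thesis using that by (simp add: coeff_gen_product[OF s])
  qed
  have mono: "monom x i \<in> tensor_space m" if "i < m" for x :: 'a and i
    using that degree_monom_le[of x i] by (auto simp: tensor_space_def)
  note expand = tensor_space_expand_monom[OF s]
  have double: "M a b = (\<Sum>i<m. \<Sum>j<m. M (monom (coeff a i) i) (monom (coeff b j) j))"
    if M: "multiplication_on (tensor_space m) (coeff_scale s) M" for M
  proof -
    have l: "linear_on (tensor_space m) (coeff_scale s) (coeff_scale s) (\<lambda>x. M x y)"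
      and r: "linear_on (tensor_space m) (coeff_scale s) (coeff_scale s) (M y)"
      if "y \<in> tensor_space m" for y
      using M that by (auto simp: multiplication_on_def bilinear_on_def)
    note lin = linear_on_sum[OF W W subspace_tensor_space[OF s m]]
    have "M a b = M (\<Sum>i<m. monom (coeff a i) i) b"
      using expand[OF a] by simp
    also have "\<dots> = (\<Sum>i<m. M (monom (coeff a i) i) b)"
      by (rule lin[OF l[OF b]]) (auto intro: mono)
    also have "\<dots> = (\<Sum>i<m. M (monom (coeff a i) i) (\<Sum>j<m. monom (coeff b j) j))"
      using expand[OF b] by simp
    also have "\<dots> = (\<Sum>i<m. \<Sum>j<m. M (monom (coeff a i) i) (monom (coeff b j) j))"
      by (intro sum.cong refl lin[OF r]) (auto intro: mono)
    finally show ?thesis .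
  qed
  show ?thesis
    unfolding double[OF assms(3)] double[OF assms(4)] by (auto intro!: sum.cong gen)
qed

lemma coeff_scale_monom:
  assumes "vector_space s"
  shows "coeff_scale s c (monom x i) = monom (s c x) i"
proof -
  interpret vector_space s by fact
  show ?thesis by (simp add: poly_eq_iff coeff_coeff_scale[OF assms])
qed

section \<open>Construction of the product from its coefficients\<close>

locale compatible_pair = vector_space scale
  for scale :: "complex \<Rightarrow> 'v::ab_group_add \<Rightarrow> 'v" (infixr \<open>*s\<close> 75) +
  fixes star circ :: "'v \<Rightarrow> 'v \<Rightarrow> 'v" and m :: nat and q :: "complex poly"
  assumes star: "multiplication_on UNIV scale star"
    and circ: "multiplication_on UNIV scale circ"
    and compatible: "compatible_multiplications scale star circ"
    and degree_q: "degree q = m"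
begin

lemma bilinear:
  "star (x + x') y = star x y + star x' y" "star x (y + y') = star x y + star x y'"
  "star (c *s x) y = c *s star x y" "star x (c *s y) = c *s star x y"
  "circ (x + x') y = circ x y + circ x' y" "circ x (y + y') = circ x y + circ x y'"
  "circ (c *s x) y = c *s circ x y" "circ x (c *s y) = c *s circ x y"
  using star circ by (simp_all add: multiplication_on_def bilinear_on_def linear_on_def)

abbreviation scaleW :: "complex \<Rightarrow> 'v poly \<Rightarrow> 'v poly" (infixr \<open>*w\<close> 75)
  where "scaleW \<equiv> coeff_scale scale"

lemmas W = vector_space_coeff_scale[OF vector_space_axioms]

sublocale W: vector_space scaleW by (rule W)

lemmas scaleW_monom = coeff_scale_monom[OF vector_space_axioms]

text \<open>The product \<open>\<cdot>\<^sub>c\<close> of the introduction.\<close>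

definition pencil :: "complex \<Rightarrow> 'v \<Rightarrow> 'v \<Rightarrow> 'v"
  where "pencil c x y = star x y + c *s circ x y"

lemma pencil_assoc: "pencil c (pencil c x y) z = pencil c x (pencil c y z)"
  using compatible
  by (simp add: compatible_multiplications_def associative_multiplication_on_def pencil_def)

text \<open>The coefficient of \<open>z\<^sup>l\<close> in \<open>(x \<star> y)(z) + z (x \<circ> y)(z)\<close>.\<close>

definition pencil_coeff :: "'v \<Rightarrow> 'v \<Rightarrow> nat \<Rightarrow> 'v poly"
  where "pencil_coeff x y l = (if l < m then monom (star x y) l else 0) +
    (if 0 < l \<and> l \<le> m then monom (circ x y) (l - 1) else 0)"

text \<open>The coefficient of \<open>u\<^sup>k v\<^sup>l\<close> in the product formula multiplied by \<open>u - v\<close>.\<close>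

definition numer_coeff :: "'v \<Rightarrow> 'v \<Rightarrow> nat \<Rightarrow> nat \<Rightarrow> 'v poly"
  where "numer_coeff x y k l = coeff q k *w pencil_coeff x y l - coeff q l *w pencil_coeff x y k"

text \<open>Division by \<open>u - v\<close>, from the geometric expansion of \<open>1 / (u - v)\<close> in powers of \<open>v / u\<close>.\<close>

definition prod_coeff :: "'v \<Rightarrow> 'v \<Rightarrow> nat \<Rightarrow> nat \<Rightarrow> 'v poly"
  where "prod_coeff x y i j = (\<Sum>r\<le>j. numer_coeff x y (i + 1 + r) (j - r))"

text \<open>The bilinear extension of the products \<open>prod_coeff x y i j\<close>. Coefficients
  of index \<open>m\<close> or more are dropped, which makes the map bilinear on all polynomials and
  spares carrier conditions.\<close>

definition mul :: "'v poly \<Rightarrow> 'v poly \<Rightarrow> 'v poly"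
  where "mul a b = (\<Sum>i<m. \<Sum>j<m. prod_coeff (coeff a i) (coeff b j) i j)"

lemma pencil_coeff_linear:
  "pencil_coeff (x + x') y l = pencil_coeff x y l + pencil_coeff x' y l"
  "pencil_coeff x (y + y') l = pencil_coeff x y l + pencil_coeff x y' l"
  "pencil_coeff (c *s x) y l = c *w pencil_coeff x y l"
  "pencil_coeff x (c *s y) l = c *w pencil_coeff x y l"
  by (simp_all add: pencil_coeff_def bilinear add_monom[symmetric] W.scale_right_distrib scaleW_monom)

lemma prod_coeff_linear:
  "prod_coeff (x + x') y i j = prod_coeff x y i j + prod_coeff x' y i j"
  "prod_coeff x (y + y') i j = prod_coeff x y i j + prod_coeff x y' i j"
  "prod_coeff (c *s x) y i j = c *w prod_coeff x y i j"
  "prod_coeff x (c *s y) i j = c *w prod_coeff x y i j"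
  by (simp_all add: prod_coeff_def numer_coeff_def pencil_coeff_linear W.scale_right_distrib
      W.scale_right_diff_distrib W.scale_sum_right mult.commute sum.distrib[symmetric] algebra_simps)

lemma mul_linear:
  "mul (a + a') b = mul a b + mul a' b"
  "mul a (b + b') = mul a b + mul a b'"
  "mul (c *w a) b = c *w mul a b"
  "mul a (c *w b) = c *w mul a b"
  by (simp_all add: mul_def prod_coeff_linear coeff_coeff_scale[OF vector_space_axioms]
      sum.distrib W.scale_sum_right)

lemma prod_coeff_zero: "prod_coeff 0 y i j = 0" "prod_coeff x 0 i j = 0"
  using prod_coeff_linear(1)[of 0 0] prod_coeff_linear(2)[of x 0 0] by simp_all

lemma mul_zero: "mul 0 b = 0" "mul a 0 = 0"
  by (simp_all add: mul_def prod_coeff_zero)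

lemma mul_diff: "mul (a - a') b = mul a b - mul a' b" "mul a (b - b') = mul a b - mul a b'"
  by (simp_all add: eq_diff_eq mul_linear[symmetric])

lemma mul_sum: "mul (\<Sum>i\<in>I. f i) b = (\<Sum>i\<in>I. mul (f i) b)" "mul a (\<Sum>i\<in>I. f i) = (\<Sum>i\<in>I. mul a (f i))"
  by (induction I rule: infinite_finite_induct) (simp_all add: mul_zero mul_linear)

lemma mul_monom:
  assumes "i < m" "j < m"
  shows "mul (monom x i) (monom y j) = prod_coeff x y i j"
proof -
  have "mul (monom x i) (monom y j)
    = (\<Sum>k<m. \<Sum>l<m. if k = i \<and> l = j then prod_coeff x y i j else 0)"
    unfolding mul_def by (intro sum.cong refl) (auto simp: prod_coeff_zero)
  then show ?thesis using assms by (simp only: sum_delta_pair simp_thms if_True)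
qed

lemma pencil_coeff_in_tensor_space: "m \<ge> 1 \<Longrightarrow> pencil_coeff x y l \<in> tensor_space m"
  unfolding pencil_coeff_def tensor_space_def mem_Collect_eq
  \<comment> \<open>This bound serves both summands: the first is present only for
    \<open>l < m\<close>, and the second has its degree lowered by one.\<close>
  by (rule degree_add_less; rule le_less_trans[where y = "min l (m - 1)"])
    (auto intro!: order.trans[OF degree_monom_le])

lemma mul_in_tensor_space:
  assumes "m \<ge> 1"
  shows "mul a b \<in> tensor_space m"
proof -
  note sub = subspace_tensor_space[OF vector_space_axioms assms]
  show ?thesis
    unfolding mul_def prod_coeff_def numer_coeff_def
    by (intro W.subspace_sum[OF sub] W.subspace_diff[OF sub] W.subspace_scale[OF sub]
        pencil_coeff_in_tensor_space[OF assms])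
qed

section \<open>Exact division by u - v and the product formula\<close>

lemma numer_coeff_eq_0: "k > m \<or> l > m \<Longrightarrow> numer_coeff x y k l = 0"
  using degree_q by (auto simp: numer_coeff_def pencil_coeff_def coeff_eq_0)

text \<open>The numerator is antisymmetric under exchange of u and v, so it vanishes at
  \<open>u = v\<close>; these sums are the coefficients of its restriction to the diagonal. This is
  what makes the division by \<open>u - v\<close> exact.\<close>

lemma sum_numer_coeff_antidiagonal: "(\<Sum>r\<le>n. numer_coeff x y r (n - r)) = 0"
proof -
  have "(\<Sum>r\<le>n. coeff q r *w pencil_coeff x y (n - r)) = (\<Sum>r\<le>n. coeff q (n - r) *w pencil_coeff x y r)"
    by (rule sum.reindex_bij_witness[where i = "\<lambda>r. n - r" and j = "\<lambda>r. n - r"]) auto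
  then show ?thesis by (simp add: numer_coeff_def sum_subtractf)
qed

text \<open>The quotient has degree below \<open>m\<close> in each variable. For large
  \<open>i\<close> every summand has first index above \<open>m\<close>. For large \<open>j\<close>
  the sum is completed to a whole antidiagonal, which sums to 0, and the added terms have second
  index above \<open>m\<close>.\<close>

lemma prod_coeff_eq_0:
  assumes "i \<ge> m \<or> j \<ge> m"
  shows "prod_coeff x y i j = 0"
proof (cases "i \<ge> m")
  case True
  then show ?thesis unfolding prod_coeff_def by (auto intro!: sum.neutral numer_coeff_eq_0)
next
  case False
  have split: "(\<Sum>r\<le>i + 1 + k. f r) = (\<Sum>r\<le>i. f r) + (\<Sum>r\<le>k. f (i + 1 + r))" for f :: "nat \<Rightarrow> 'v poly" and k
    by (induction k) (simp_all add: add.assoc)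
  have "0 = (\<Sum>r\<le>i. numer_coeff x y r (i + 1 + j - r)) + prod_coeff x y i j"
    using sum_numer_coeff_antidiagonal[of x y "i + 1 + j"] unfolding split prod_coeff_def by simp
  also have "(\<Sum>r\<le>i. numer_coeff x y r (i + 1 + j - r)) = 0"
    using assms False by (auto intro!: sum.neutral numer_coeff_eq_0)
  finally show ?thesis by simp
qed

text \<open>The two sums run along the same antidiagonal and differ exactly by the term at
  \<open>(i, j)\<close>. For \<open>i = 0\<close> the longer sum is the whole antidiagonal, hence 0,
  in agreement with the default value.\<close>

lemma prod_coeff_recurrence:
  "(if i = 0 then 0 else prod_coeff x y (i - 1) j) - (if j = 0 then 0 else prod_coeff x y i (j - 1))
    = numer_coeff x y i j"
proof (cases j)
  case 0
  then show ?thesis by (simp add: prod_coeff_def) (simp add: numer_coeff_def)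
next
  case (Suc k)
  have "(\<Sum>r\<le>j. numer_coeff x y (i + r) (j - r)) = numer_coeff x y i j + prod_coeff x y i k"
    unfolding prod_coeff_def Suc sum.atMost_Suc_shift by simp
  moreover have "(\<Sum>r\<le>j. numer_coeff x y (i + r) (j - r)) = (if i = 0 then 0 else prod_coeff x y (i - 1) j)"
    using sum_numer_coeff_antidiagonal[of x y j] by (auto simp: prod_coeff_def)
  ultimately have eq: "(if i = 0 then 0 else prod_coeff x y (i - 1) j) = numer_coeff x y i j + prod_coeff x y i k"
    by (rule trans[OF sym, rotated])
  show ?thesis unfolding eq using Suc by simp
qed

lemma product_formula_mul: "product_formula scale m q star circ mul"
proof -
  note V = vector_space_axioms
  have A: "coeff (gen_poly scale m (star x y) + poly_act scaleW [:0, 1:] (gen_poly scale m (circ x y))) l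
      = pencil_coeff x y l" for x y l
    by (auto simp: coeff_act_var[OF W] coeff_gen_poly[OF V] pencil_coeff_def)
  \<comment> \<open>Outside the square of indices below \<open>m\<close> both sides are 0, so no
    case distinction remains.\<close>
  have P: "coeff (coeff (gen_product scale m mul x y) i) j = prod_coeff x y i j" for x y i j
    by (auto simp: coeff_gen_product[OF V] mul_monom prod_coeff_eq_0)
  show ?thesis
    unfolding product_formula_def Let_def poly_eq_iff[where 'a = "'v poly poly"]
      poly_eq_iff[where 'a = "'v poly"] coeff_diff coeff_act_u_minus_v[OF W] coeff_act_in_u_in_v[OF W] coeff_act_in_v_in_u[OF W] A P
    by (intro allI prod_coeff_recurrence[unfolded numer_coeff_def])
qed

section \<open>Evaluation of the generating functions at numbers\<close>

text \<open>The value at the number \<open>z\<close> of the generating polynomial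
  \<open>x(u)\<close>.\<close>

definition gen :: "complex \<Rightarrow> 'v \<Rightarrow> 'v poly"
  where "gen z x = (\<Sum>i<m. z ^ i *w monom x i)"

lemma gen_linear:
  "gen z (x + y) = gen z x + gen z y" "gen z (c *s x) = c *w gen z x"
  by (simp_all add: gen_def add_monom[symmetric] W.scale_right_distrib sum.distrib W.scale_sum_right
      scaleW_monom mult.commute)

text \<open>The factor \<open>z\<close> in front of the \<open>circ\<close> part becomes the pencil
  parameter, so parameter and point of evaluation coincide. The sum runs up to \<open>m\<close>
  because that factor raises the degree by one.\<close>

lemma sum_pencil_coeff: "(\<Sum>l\<le>m. z ^ l *w pencil_coeff x y l) = gen z (pencil z x y)"
proof -
  have "(\<Sum>l\<le>m. z ^ l *w pencil_coeff x y l)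
    = (\<Sum>l\<le>m. if l < m then z ^ l *w monom (star x y) l else 0)
    + (\<Sum>l\<le>m. if 0 < l then z ^ l *w monom (circ x y) (l - 1) else 0)"
    unfolding sum.distrib[symmetric]
    by (intro sum.cong) (auto simp: pencil_coeff_def W.scale_right_distrib)
  also have "(\<Sum>l\<le>m. if l < m then z ^ l *w monom (star x y) l else 0) = gen z (star x y)"
    unfolding gen_def lessThan_Suc_atMost[symmetric] by simp
  also have "(\<Sum>l\<le>m. if 0 < l then z ^ l *w monom (circ x y) (l - 1) else 0) = gen z (z *s circ x y)"
    unfolding gen_linear unfolding gen_def lessThan_Suc_atMost[symmetric] sum.lessThan_Suc_shift
    by (simp add: W.scale_sum_right)
  finally show ?thesis by (simp add: pencil_def gen_linear)
qed

text \<open>The product formula at two numbers, obtained by summing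
  \<open>prod_coeff_recurrence\<close> against \<open>u ^ i * v ^ j\<close>.\<close>

lemma mul_gen:
  "(u - v) *w mul (gen u x) (gen v y)
    = poly q u *w gen v (pencil v x y) - poly q v *w gen u (pencil u x y)"
proof -
  let ?p = "prod_coeff x y"
  have q: "poly q z = (\<Sum>i\<le>m. coeff q i * z ^ i)" for z
    using degree_q by (simp add: poly_altdef)
  have gen_gen: "mul (gen u x) (gen v y) = (\<Sum>i<m. \<Sum>j<m. (u ^ i * v ^ j) *w ?p i j)"
    unfolding gen_def mul_sum(1) unfolding mul_sum(2) by (simp add: mul_linear mul_monom mult.commute)
  have "u *w mul (gen u x) (gen v y) = (\<Sum>i<m. \<Sum>j<m. (u ^ Suc i * v ^ j) *w ?p i j)"
    by (simp add: gen_gen W.scale_sum_right mult_ac)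
  \<comment> \<open>The factor \<open>u\<close> is absorbed by shifting \<open>i\<close>; extending
    \<open>j\<close> to \<open>m\<close> adds only zeros by \<open>prod_coeff_eq_0\<close>.\<close>
  also have "\<dots> = (\<Sum>i\<le>m. \<Sum>j\<le>m. (u ^ i * v ^ j) *w (if i = 0 then 0 else ?p (i - 1) j))"
    unfolding sum_atMost_shift[of "\<lambda>i. \<Sum>j\<le>m. (u ^ i * v ^ j) *w (if i = 0 then 0 else ?p (i - 1) j)" m, simplified]
    by (simp add: lessThan_Suc_atMost[symmetric] prod_coeff_eq_0)
  finally have 1: "u *w mul (gen u x) (gen v y) = \<dots>" .
  have "v *w mul (gen u x) (gen v y) = (\<Sum>i<m. \<Sum>j<m. (u ^ i * v ^ Suc j) *w ?p i j)"
    by (simp add: gen_gen W.scale_sum_right mult_ac)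
  also have "\<dots> = (\<Sum>i\<le>m. \<Sum>j\<le>m. (u ^ i * v ^ j) *w (if j = 0 then 0 else ?p i (j - 1)))"
    unfolding sum_atMost_shift[of "\<lambda>j. (u ^ i * v ^ j) *w (if j = 0 then 0 else ?p i (j - 1))" m for i, simplified]
    by (simp add: lessThan_Suc_atMost[symmetric] prod_coeff_eq_0)
  finally have 2: "v *w mul (gen u x) (gen v y) = \<dots>" .
  have "(u - v) *w mul (gen u x) (gen v y) = (\<Sum>i\<le>m. \<Sum>j\<le>m. (u ^ i * v ^ j) *w numer_coeff x y i j)"
    unfolding W.scale_left_diff_distrib 1 2 sum_subtractf[symmetric] W.scale_right_diff_distrib[symmetric]
      prod_coeff_recurrence ..
  also have "\<dots> = (\<Sum>i\<le>m. \<Sum>j\<le>m. (coeff q i * u ^ i) *w v ^ j *w pencil_coeff x y j)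
    - (\<Sum>i\<le>m. \<Sum>j\<le>m. (coeff q j * v ^ j) *w u ^ i *w pencil_coeff x y i)"
    unfolding sum_subtractf[symmetric]
    by (intro sum.cong refl) (simp add: numer_coeff_def W.scale_right_diff_distrib mult_ac)
  also have "\<dots> = poly q u *w gen v (pencil v x y) - poly q v *w gen u (pencil u x y)"
    unfolding sum_pencil_coeff[symmetric] q
    by (simp only: W.scale_sum_left W.scale_sum_right)
      (simp only: W.scale_sum_left[symmetric] W.scale_sum_right[symmetric])
  finally show ?thesis .
qed

section \<open>Triple products of generating functions\<close>

lemma pencil_combine:
  "(u - w) *s pencil v x y - (v - w) *s pencil u x y = (u - v) *s pencil w x y"
  by (simp add: pencil_def algebra_simps)

lemma pencil_linear:
  "pencil c (x - x') y = pencil c x y - pencil c x' y"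
  "pencil c x (y - y') = pencil c x y - pencil c x y'"
  "pencil c (k *s x) y = k *s pencil c x y"
  "pencil c x (k *s y) = k *s pencil c x y"
proof -
  show *: "pencil c (k *s x) y = k *s pencil c x y" "pencil c x (k *s y) = k *s pencil c x y" for k x y
    by (simp_all add: pencil_def bilinear scale_right_distrib mult.commute)
  have "pencil c (x + x') y = pencil c x y + pencil c x' y"
    "pencil c x (y + y') = pencil c x y + pencil c x y'" for x x' y y'
    by (simp_all only: pencil_def bilinear scale_right_distrib add_ac)
  note this[symmetric]
  then show "pencil c (x - x') y = pencil c x y - pencil c x' y"
    "pencil c x (y - y') = pencil c x y - pencil c x y'"
    by (simp_all add: eq_diff_eq)
qed

lemma gen_diff: "gen z (x - y) = gen z x - gen z y"
  using gen_linear(1)[of z "x - y" y] by simp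

text \<open>The scalar clears all denominators: \<open>u - v\<close> is spent on the inner product,
  \<open>v - w\<close> and \<open>u - w\<close> on the two outer ones. In the result both pencil
  products of each term have the same parameter, so \<open>pencil_assoc\<close> applies term by
  term.\<close>

lemma mul_mul_gen:
  "((u - v) * (u - w) * (v - w)) *w mul (mul (gen u x) (gen v y)) (gen w z) =
    ((u - v) * poly q u * poly q v) *w gen w (pencil w (pencil w x y) z)
    - ((u - w) * poly q u * poly q w) *w gen v (pencil v (pencil v x y) z)
    + ((v - w) * poly q v * poly q w) *w gen u (pencil u (pencil u x y) z)"
  (is "_ = ?r")
proof -
  have "((u - v) * (u - w) * (v - w)) *w mul (mul (gen u x) (gen v y)) (gen w z)
    = ((u - w) * (v - w)) *w mul ((u - v) *w mul (gen u x) (gen v y)) (gen w z)"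
    by (simp add: mul_linear mult_ac)
  also have "\<dots> = ((u - w) * poly q u) *w (v - w) *w mul (gen v (pencil v x y)) (gen w z)
    - ((v - w) * poly q v) *w (u - w) *w mul (gen u (pencil u x y)) (gen w z)"
    unfolding mul_gen[of u v] by (simp add: mul_diff mul_linear W.scale_right_diff_distrib mult_ac)
  also have "\<dots> = (poly q u * poly q v) *w
      gen w (pencil w ((u - w) *s pencil v x y - (v - w) *s pencil u x y) z)
    - ((u - w) * poly q u * poly q w) *w gen v (pencil v (pencil v x y) z)
    + ((v - w) * poly q v * poly q w) *w gen u (pencil u (pencil u x y) z)"
    unfolding mul_gen
    by (simp add: pencil_linear gen_diff gen_linear W.scale_right_diff_distrib mult_ac)
  \<comment> \<open>The inner products with parameters \<open>u\<close> and \<open>v\<close> merge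
    into one with parameter \<open>w\<close>, that of the outer product.\<close>
  also have "\<dots> = ?r"
    unfolding pencil_combine by (simp add: pencil_linear gen_linear mult_ac)
  finally show ?thesis .
qed

text \<open>The mirror image of \<open>mul_mul_gen\<close>: here the two terms evaluated at
  \<open>u\<close> merge, by the interpolation identity with \<open>u\<close> as target
  parameter.\<close>

lemma mul_gen_mul:
  "((u - v) * (u - w) * (v - w)) *w mul (gen u x) (mul (gen v y) (gen w z)) =
    ((u - v) * poly q u * poly q v) *w gen w (pencil w x (pencil w y z))
    - ((u - w) * poly q u * poly q w) *w gen v (pencil v x (pencil v y z))
    + ((v - w) * poly q v * poly q w) *w gen u (pencil u x (pencil u y z))"
  (is "_ = ?r")
proof -
  have combine: "(u - w) *s pencil v y z - (u - v) *s pencil w y z = (v - w) *s pencil u y z"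
    by (simp add: pencil_def algebra_simps)
  have "((u - v) * (u - w) * (v - w)) *w mul (gen u x) (mul (gen v y) (gen w z))
    = ((u - v) * (u - w)) *w mul (gen u x) ((v - w) *w mul (gen v y) (gen w z))"
    by (simp add: mul_linear mult_ac)
  also have "\<dots> = ((u - v) * poly q v) *w (u - w) *w mul (gen u x) (gen w (pencil w y z))
    - ((u - w) * poly q w) *w (u - v) *w mul (gen u x) (gen v (pencil v y z))"
    unfolding mul_gen[of v w] by (simp add: mul_diff mul_linear W.scale_right_diff_distrib mult_ac)
  also have "\<dots> = (poly q v * poly q w) *w
      gen u (pencil u x ((u - w) *s pencil v y z - (u - v) *s pencil w y z))
    + ((u - v) * poly q u * poly q v) *w gen w (pencil w x (pencil w y z))
    - ((u - w) * poly q u * poly q w) *w gen v (pencil v x (pencil v y z))"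
    unfolding mul_gen
    by (simp add: pencil_linear gen_diff gen_linear W.scale_right_diff_distrib mult_ac)
  also have "\<dots> = ?r"
    unfolding combine by (simp add: pencil_linear gen_linear mult_ac)
  finally show ?thesis .
qed

section \<open>Vanishing of the associator\<close>

definition assoc :: "'v poly \<Rightarrow> 'v poly \<Rightarrow> 'v poly \<Rightarrow> 'v poly"
  where "assoc a b c = mul (mul a b) c - mul a (mul b c)"

text \<open>The two expansions agree by associativity of the pencil, and distinctness allows
  division by the common scalar.\<close>

lemma assoc_gen:
  assumes "u \<noteq> v" "u \<noteq> w" "v \<noteq> w"
  shows "assoc (gen u x) (gen v y) (gen w z) = 0"
proof -
  have "((u - v) * (u - w) * (v - w)) *w assoc (gen u x) (gen v y) (gen w z) = 0"
    unfolding assoc_def W.scale_right_diff_distrib mul_mul_gen mul_gen_mul by (simp add: pencil_assoc)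
  with assms show ?thesis by simp
qed

lemma assoc_sum:
  "assoc (\<Sum>i\<in>I. f i) b c = (\<Sum>i\<in>I. assoc (f i) b c)"
  "assoc a (\<Sum>i\<in>I. f i) c = (\<Sum>i\<in>I. assoc a (f i) c)"
  "assoc a b (\<Sum>i\<in>I. f i) = (\<Sum>i\<in>I. assoc a b (f i))"
  by (simp_all add: assoc_def mul_sum sum_subtractf)

lemma assoc_scale:
  "assoc (k *w a) b c = k *w assoc a b c"
  "assoc a (k *w b) c = k *w assoc a b c"
  "assoc a b (k *w c) = k *w assoc a b c"
  by (simp_all add: assoc_def mul_linear W.scale_right_diff_distrib)

text \<open>Coefficients are extracted one variable at a time. The excluded set shrinks from
  \<open>{v, w}\<close> to \<open>{w}\<close> to the empty set, since each extracted variable no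
  longer has to be avoided.\<close>

lemma assoc_monom:
  assumes "i < m" "j < m" "k < m"
  shows "assoc (monom x i) (monom y j) (monom z k) = 0"
proof -
  note vanish = power_sum_cofinite_eq_0[OF W, where n = m]
  have 1: "assoc (monom x i) (gen v y) (gen w z) = 0" if "v \<noteq> w" for v w
    using assoc_gen[of _ v w x y z] that \<open>i < m\<close>
    by (intro vanish[where S = "{v, w}" and a = "\<lambda>i. assoc (monom x i) (gen v y) (gen w z)"])
      (auto simp: gen_def[of _ x] assoc_sum assoc_scale)
  have 2: "assoc (monom x i) (monom y j) (gen w z) = 0" for w
    using 1[of _ w] \<open>j < m\<close>
    by (intro vanish[where S = "{w}" and a = "\<lambda>j. assoc (monom x i) (monom y j) (gen w z)"])
      (auto simp: gen_def[of _ y] assoc_sum assoc_scale)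
  show ?thesis
    using 2 \<open>k < m\<close>
    by (intro vanish[where S = "{}" and a = "\<lambda>k. assoc (monom x i) (monom y j) (monom z k)"])
      (auto simp: gen_def[of _ z] assoc_sum assoc_scale)
qed

lemma mul_assoc:
  assumes "a \<in> tensor_space m" "b \<in> tensor_space m" "c \<in> tensor_space m"
  shows "mul (mul a b) c = mul a (mul b c)"
proof -
  note expand = tensor_space_expand_monom[OF vector_space_axioms]
  have "assoc a b c = 0"
    by (subst expand[OF assms(1)], subst expand[OF assms(2)], subst expand[OF assms(3)])
      (simp add: assoc_sum assoc_monom)
  then show ?thesis by (simp add: assoc_def)
qed

lemma multiplication_mul: "m \<ge> 1 \<Longrightarrow> multiplication_on (tensor_space m) scaleW mul"
  by (simp add: multiplication_on_def bilinear_on_def linear_on_def mul_in_tensor_space mul_linear)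

end

theorem theorem1p1:
  fixes scale :: "complex \<Rightarrow> 'v::ab_group_add \<Rightarrow> 'v" and Basis :: "'v set"
    and star circ :: "'v \<Rightarrow> 'v \<Rightarrow> 'v" and m :: nat and q :: "complex poly"
  assumes "finite_dimensional_vector_space scale Basis"
    and "associative_multiplication_on UNIV scale star"
    and "associative_multiplication_on UNIV scale circ"
    and "compatible_multiplications scale star circ"
    and "m \<ge> 1"
    and "degree q = m"
  shows "\<exists>mul :: 'v poly \<Rightarrow> 'v poly \<Rightarrow> 'v poly.
      associative_multiplication_on (tensor_space m) (coeff_scale scale) mul \<and>
      product_formula scale m q star circ mul \<and>
      (\<forall>mul'. multiplication_on (tensor_space m) (coeff_scale scale) mul' \<and>
          product_formula scale m q star circ mul' \<longrightarrow>
        (\<forall>a\<in>tensor_space m. \<forall>b\<in>tensor_space m. mul' a b = mul a b))"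
proof -
  interpret finite_dimensional_vector_space scale Basis by fact
  interpret compatible_pair scale star circ m q
    using assms(2-) by unfold_locales (auto simp: associative_multiplication_on_def)
  note mult = multiplication_mul[OF \<open>m \<ge> 1\<close>]
  have "associative_multiplication_on (tensor_space m) (coeff_scale scale) mul"
    using mult mul_assoc by (simp add: associative_multiplication_on_def)
  moreover have "mul' a b = mul a b"
    if "multiplication_on (tensor_space m) (coeff_scale scale) mul'"
      "product_formula scale m q star circ mul'" "a \<in> tensor_space m" "b \<in> tensor_space m" for mul' a b
    by (rule product_formula_unique[OF vector_space_axioms \<open>m \<ge> 1\<close> mult that(1) product_formula_mul that(2-)])
  ultimately show ?thesis
    using product_formula_mul by blast
qed

end
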